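(* Let $G$ be a topological group and let $bG$ be a Hausdorff compactification of $G$. If $Y = bG \setminus G$ is locally a hereditarily D-space, then at least one of the following conditions holds: (1) $G$ is metrizable; (2) $bG$ can be continuously mapped onto the Tychonoff cube $I^{\omega_1}$.
   Context: All spaces (including topological groups) are assumed Hausdorff. A Hausdorff compactification $bG$ of $G$ is a compact Hausdorff space containing $G$ as a dense subspace. A neighborhood assignment for a space $X$ is a function $\varphi$ from $X$ to the topology of $X$ such that $x \in \varphi(x)$ for each $x \in X$. A space $X$ is a D-space if for every neighborhood assignment $\varphi$ for $X$ there is a closed discrete subset $D$ of $X$ such that $X = \bigcup_{d \in D}\varphi(d)$. A space is a hereditarily D-space if each of its subspaces is a D-space. A space $X$ is locally a hereditarily D-space if for each $x \in X$ there is an open set $U$ with $x \in U$ such that the subspace $U$ is a hereditarily D-space. $I=[0,1]$, and $I^{\omega_1}$ carries the product topology. *)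

theory Defs
  imports "HOL-Analysis.Analysis" "HOL-Algebra.Group"
begin

definition topological_group :: "('a, 'b) monoid_scheme \<Rightarrow> 'a topology \<Rightarrow> bool" where
  "topological_group G T \<longleftrightarrow>
     group G \<and> topspace T = carrier G \<and> Hausdorff_space T \<and>
     continuous_map (prod_topology T T) T (\<lambda>(x, y). x \<otimes>\<^bsub>G\<^esub> y) \<and>
     continuous_map T T (\<lambda>x. inv\<^bsub>G\<^esub> x)"

definition Hausdorff_compactification :: "'a topology \<Rightarrow> 'a topology \<Rightarrow> bool" where
  "Hausdorff_compactification B X \<longleftrightarrow>
     compact_space B \<and> Hausdorff_space B \<and>
     topspace X \<subseteq> topspace B \<and> subtopology B (topspace X) = X \<and>
     B closure_of (topspace X) = topspace B"

text \<open>Only the values of a neighborhood assignment on \<open>topspace X\<close> are relevant.\<close>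

definition neighborhood_assignment :: "'a topology \<Rightarrow> ('a \<Rightarrow> 'a set) \<Rightarrow> bool" where
  "neighborhood_assignment X \<phi> \<longleftrightarrow> (\<forall>x\<in>topspace X. openin X (\<phi> x) \<and> x \<in> \<phi> x)"

text \<open>The notions below do not include the Hausdorff axiom; they are meant for Hausdorff spaces
  such as the subspaces of a compactification.\<close>

definition D_space :: "'a topology \<Rightarrow> bool" where
  "D_space X \<longleftrightarrow>
     (\<forall>\<phi>. neighborhood_assignment X \<phi> \<longrightarrow>
        (\<exists>D. closedin X D \<and> subtopology X D = discrete_topology D \<and>
             topspace X = (\<Union>d\<in>D. \<phi> d)))"

definition hereditarily_D_space :: "'a topology \<Rightarrow> bool" where
  "hereditarily_D_space X \<longleftrightarrow> (\<forall>S\<subseteq>topspace X. D_space (subtopology X S))"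

definition locally_hereditarily_D_space :: "'a topology \<Rightarrow> bool" where
  "locally_hereditarily_D_space X \<longleftrightarrow>
     (\<forall>x\<in>topspace X. \<exists>U. openin X U \<and> x \<in> U \<and> hereditarily_D_space (subtopology X U))"

text \<open>The cardinal \<open>\<omega>\<^sub>1\<close> is the successor of \<open>natLeq\<close>, a well-order relation on its field;
  the field is the underlying set, of cardinality \<open>\<aleph>\<^sub>1\<close>.\<close>

definition omega_1 :: "nat set set" where
  "omega_1 = Field (cardSuc natLeq)"

definition Tychonoff_cube_omega_1 :: "(nat set \<Rightarrow> real) topology" where
  "Tychonoff_cube_omega_1 = product_topology (\<lambda>_. top_of_set {0..1}) omega_1"

definition continuously_maps_onto :: "'a topology \<Rightarrow> 'b topology \<Rightarrow> bool" where
  "continuously_maps_onto X Y \<longleftrightarrow>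
     (\<exists>f. continuous_map X Y f \<and> f ` topspace X = topspace Y)"

end

theory Submission
  imports Defs
begin

text \<open>Call a point of \<open>bG\<close> good if it has a countable local \<open>\<pi>\<close>-base. The proof plays two facts about good
  points against each other.

  If \<open>G\<close> is not metrizable, then no point of \<open>G\<close> is good. A countable local \<open>\<pi>\<close>-base in \<open>bG\<close> at a point of the
  dense subspace \<open>G\<close> restricts to \<open>G\<close>; translating its members to the identity gives a countable base at the
  identity, and the Birkhoff--Kakutani theorem gives a metric
  (\<open>countable_local_pi_base_imp_metrizable\<close>). So all good points lie in the remainder \<open>Y\<close>.

  If the good points are not dense in \<open>bG\<close>, then \<open>bG\<close> maps onto the cube. This is the case of Shapirovskii's
  theorem that is needed here (\<open>Shapirovskii_omega_1\<close>). On an open set without good points, every countable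
  family of open sets in a suitable smaller open set is split by a pair of open sets with disjoint closures
  (\<open>countable_families_split_somewhere\<close>). Hence a maximal independent family of such pairs is uncountable, and
  its Urysohn functions combine into the required map.

  It remains to refute that the good points are dense and all in \<open>Y\<close>
  (\<open>open_set_without_countable_local_pi_bases\<close>). The set of good points contains the closure of each of its
  countable subsets. Near any point of \<open>Y\<close> it is also a D-space, by the assumption on \<open>Y\<close>. Both together
  make its part in a small closed neighborhood compact, because a closed discrete subset has to be finite.
  By density this part contains a nonempty open subset of \<open>bG\<close>, which then lies in \<open>Y\<close>, although \<open>G\<close> is
  dense.\<close>

(* Two competing closure notations make every formula about closures ambiguous. *)
no_notation Congruence.eq_closure_of (\<open>closure'_of\<index>\<close>)

section \<open>Countable local \<open>\<pi>\<close>-bases\<close>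

text \<open>A family of nonempty open sets is a local \<open>\<pi>\<close>-base at \<open>x\<close> if each neighborhood of \<open>x\<close> contains a
  member; the members need not contain \<open>x\<close>. This says that the \<open>\<pi>\<close>-character at \<open>x\<close> is countable.\<close>
definition countable_local_pi_base :: "'a topology \<Rightarrow> 'a \<Rightarrow> bool" where
  "countable_local_pi_base X x \<longleftrightarrow>
     (\<exists>\<U>. countable \<U> \<and> (\<forall>U\<in>\<U>. openin X U \<and> U \<noteq> {}) \<and>
          (\<forall>W. openin X W \<and> x \<in> W \<longrightarrow> (\<exists>U\<in>\<U>. U \<subseteq> W)))"

text \<open>Because the members of a local \<open>\<pi>\<close>-base at \<open>a\<close> need not contain \<open>a\<close>, the union of local
  \<open>\<pi>\<close>-bases at the points of \<open>A\<close> is one at each point of the closure of \<open>A\<close>. First countability has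
  no such property.\<close>
lemma countable_local_pi_base_closure_of_countable:
  assumes A: "countable A" "\<And>a. a \<in> A \<Longrightarrow> countable_local_pi_base X a"
    and x: "x \<in> X closure_of A"
  shows "countable_local_pi_base X x"
proof -
  have "\<forall>a\<in>A. \<exists>\<U>. countable \<U> \<and> (\<forall>U\<in>\<U>. openin X U \<and> U \<noteq> {}) \<and>
          (\<forall>W. openin X W \<and> a \<in> W \<longrightarrow> (\<exists>U\<in>\<U>. U \<subseteq> W))"
    using A(2) by (simp add: countable_local_pi_base_def)
  from bchoice[OF this] obtain \<U> where \<U>: "\<forall>a\<in>A. countable (\<U> a) \<and> (\<forall>U\<in>\<U> a. openin X U \<and> U \<noteq> {}) \<and>
          (\<forall>W. openin X W \<and> a \<in> W \<longrightarrow> (\<exists>U\<in>\<U> a. U \<subseteq> W))"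
    by (elim exE)
  show ?thesis
    unfolding countable_local_pi_base_def
  proof (intro exI[of _ "\<Union>(\<U> ` A)"] conjI allI impI)
    show "countable (\<Union>(\<U> ` A))"
      using A(1) \<U> by (intro countable_UN) simp_all
    show "\<forall>U\<in>\<Union>(\<U> ` A). openin X U \<and> U \<noteq> {}"
      using \<U> by simp
    fix W assume W: "openin X W \<and> x \<in> W"
    then obtain a where "a \<in> A" "a \<in> W"
      using x unfolding in_closure_of by blast
    then show "\<exists>U\<in>\<Union>(\<U> ` A). U \<subseteq> W"
      using \<U> W by (meson UN_I)
  qed
qed

lemma countable_local_pi_base_dense_subspace:
  assumes dense: "X closure_of S = topspace X" and x: "x \<in> S" "countable_local_pi_base X x"
  shows "countable_local_pi_base (subtopology X S) x"
proof -
  from x(2) obtain \<U> where \<U>: "countable \<U>" "\<forall>U\<in>\<U>. openin X U \<and> U \<noteq> {}"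
    "\<forall>W. openin X W \<and> x \<in> W \<longrightarrow> (\<exists>U\<in>\<U>. U \<subseteq> W)"
    unfolding countable_local_pi_base_def by (elim exE conjE)
  show ?thesis
    unfolding countable_local_pi_base_def
  proof (intro exI[of _ "(\<inter>) S ` \<U>"] conjI allI impI)
    show "countable ((\<inter>) S ` \<U>)"
      using \<U>(1) by simp
    show "\<forall>U\<in>(\<inter>) S ` \<U>. openin (subtopology X S) U \<and> U \<noteq> {}"
    proof (intro ballI)
      fix U' assume "U' \<in> (\<inter>) S ` \<U>"
      then obtain U where U: "U' = S \<inter> U" "openin X U" "U \<noteq> {}"
        using \<U>(2) by blast
      have "S \<inter> U \<noteq> {}"
        using dense U(2,3) by (simp add: dense_intersects_open)
      with U show "openin (subtopology X S) U' \<and> U' \<noteq> {}"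
        by (simp add: openin_subtopology_Int2)
    qed
    fix W assume W: "openin (subtopology X S) W \<and> x \<in> W"
    then obtain W' where W': "openin X W'" "W = W' \<inter> S"
      unfolding openin_subtopology by blast
    then obtain U where U: "U \<in> \<U>" "U \<subseteq> W'"
      using \<U>(3) W by blast
    then have "S \<inter> U \<subseteq> W"
      using W'(2) by auto
    with U(1) show "\<exists>U\<in>(\<inter>) S ` \<U>. U \<subseteq> W"
      by (intro bexI[of _ "S \<inter> U"] imageI)
  qed
qed

section \<open>Independent pairs of open sets\<close>

lemma openin_subset_closure_of: "openin X U \<Longrightarrow> U \<subseteq> X closure_of U"
  by (simp add: closure_of_subset openin_subset)

text \<open>The closures, not only the sets, are disjoint so that a Urysohn function separates \<open>P\<close> from \<open>Q\<close>.\<close>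
definition splits :: "'a topology \<Rightarrow> 'a set set \<Rightarrow> 'a set \<Rightarrow> 'a set \<Rightarrow> bool" where
  "splits X \<V> P Q \<longleftrightarrow>
     openin X P \<and> openin X Q \<and> disjnt (X closure_of P) (X closure_of Q) \<and>
     (\<forall>V\<in>\<V>. P \<inter> V \<noteq> {} \<and> Q \<inter> V \<noteq> {})"

text \<open>Shrinking \<open>A\<close> and \<open>B\<close> to \<open>A'\<close> and \<open>B'\<close> that still cover the closure of \<open>S\<close>, the sets \<open>S\<close> minus the
  closure of \<open>A'\<close> and \<open>S\<close> minus the closure of \<open>B'\<close> have disjoint closures. A member of \<open>\<V>\<close> that
  missed the first would have its closure inside \<open>A\<close>, and likewise for \<open>B\<close>.\<close>
lemma splits_from_two_set_cover:
  assumes X: "normal_space X" and S: "openin X S"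
    and AB: "openin X A" "openin X B" "X closure_of S \<subseteq> A \<union> B"
    and \<V>: "\<And>V. V \<in> \<V> \<Longrightarrow> V \<subseteq> S \<and> \<not> X closure_of V \<subseteq> A \<and> \<not> X closure_of V \<subseteq> B"
  shows "\<exists>P Q. splits X \<V> P Q"
proof -
  let ?C = "X closure_of S"
  have *: "\<exists>V. openin X V \<and> S \<subseteq> V \<and> X closure_of V \<subseteq> U"
    if "closedin X S" "openin X U" "S \<subseteq> U" for S U
    using X that unfolding normal_space_alt by blast
  have "closedin X (?C - B)" "?C - B \<subseteq> A"
    using AB by (auto simp: closedin_diff)
  then obtain A' where A': "openin X A'" "?C - B \<subseteq> A'" "X closure_of A' \<subseteq> A"
    using * AB by metis
  have "closedin X (?C - A')" "?C - A' \<subseteq> B"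
    using A' by (auto simp: closedin_diff)
  then obtain B' where B': "openin X B'" "?C - A' \<subseteq> B'" "X closure_of B' \<subseteq> B"
    using * AB by metis
  define P where "P = S - X closure_of A'"
  define Q where "Q = S - X closure_of B'"
  have PQ: "openin X P" "openin X Q"
    unfolding P_def Q_def using S by (simp_all add: openin_diff)
  have shrink: "X closure_of (S - X closure_of W) \<subseteq> ?C - W" if "openin X W" for W
  proof (rule closure_of_minimal)
    show "S - X closure_of W \<subseteq> ?C - W"
      using openin_subset_closure_of[OF S] openin_subset_closure_of[OF that] by blast
    show "closedin X (?C - W)"
      using that by (auto simp: closedin_diff)
  qed
  have "disjnt (X closure_of P) (X closure_of Q)"
    using shrink[OF A'(1)] shrink[OF B'(1)] B'(2) unfolding P_def[symmetric] Q_def[symmetric] disjnt_iff by blast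
  moreover have "P \<inter> V \<noteq> {} \<and> Q \<inter> V \<noteq> {}" if "V \<in> \<V>" for V
  proof -
    have "X closure_of V \<subseteq> X closure_of W" if "V \<subseteq> X closure_of W" for W
      using that by (simp add: closure_of_minimal)
    from this[of A'] this[of B'] have "\<not> V \<subseteq> X closure_of A'" "\<not> V \<subseteq> X closure_of B'"
      using \<V>[OF that] A'(3) B'(3) by auto
    then show ?thesis
      using \<V>[OF that] by (auto simp: P_def Q_def)
  qed
  ultimately show ?thesis
    using PQ unfolding splits_def by blast
qed

text \<open>Otherwise each open \<open>S\<close> below \<open>S0\<close> carries a countable family \<open>\<V> S\<close> that nothing splits, and closing
  \<open>{S0}\<close> under \<open>\<V>\<close> gives a countable family \<open>\<W>\<close>. As \<open>\<W>\<close> is a local \<open>\<pi>\<close>-base at no point, compactness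
  yields a finite open cover \<open>\<F>\<close> of the closure of \<open>S0\<close> none of whose members contains a member of \<open>\<W>\<close>.
  Take \<open>S\<close> in \<open>\<W>\<close> whose closure is covered by the fewest members of \<open>\<F>\<close>, and divide that cover into
  one member and the union of the others: by minimality this two-set cover splits \<open>\<V> S\<close>.\<close>
lemma countable_families_split_somewhere:
  assumes X: "compact_space X" "Hausdorff_space X"
    and S0: "openin X S0" "S0 \<noteq> {}"
    and no_pi: "\<forall>x \<in> X closure_of S0. \<not> countable_local_pi_base X x"
  shows "\<exists>S. openin X S \<and> S \<noteq> {} \<and> S \<subseteq> S0 \<and>
           (\<forall>\<V>. countable \<V> \<and> (\<forall>V\<in>\<V>. openin X V \<and> V \<noteq> {} \<and> V \<subseteq> S) \<longrightarrow> (\<exists>P Q. splits X \<V> P Q))"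
proof (rule ccontr)
  assume contra: "\<not> ?thesis"
  have normal: "normal_space X"
    using X compact_Hausdorff_or_regular_imp_normal_space by blast
  have "\<exists>\<V>. openin X S \<and> S \<noteq> {} \<and> S \<subseteq> S0 \<longrightarrow>
      countable \<V> \<and> (\<forall>V\<in>\<V>. openin X V \<and> V \<noteq> {} \<and> V \<subseteq> S) \<and> \<not> (\<exists>P Q. splits X \<V> P Q)" for S
  proof (cases "openin X S \<and> S \<noteq> {} \<and> S \<subseteq> S0")
    case True
    with contra have "\<not> (\<forall>\<V>. countable \<V> \<and> (\<forall>V\<in>\<V>. openin X V \<and> V \<noteq> {} \<and> V \<subseteq> S) \<longrightarrow> (\<exists>P Q. splits X \<V> P Q))"
      by (metis (no_types, lifting))
    then show ?thesis
      by (metis (no_types, lifting))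
  qed auto
  then have "\<forall>S. \<exists>\<V>. openin X S \<and> S \<noteq> {} \<and> S \<subseteq> S0 \<longrightarrow>
      countable \<V> \<and> (\<forall>V\<in>\<V>. openin X V \<and> V \<noteq> {} \<and> V \<subseteq> S) \<and> \<not> (\<exists>P Q. splits X \<V> P Q)"
    by (rule allI)
  from choice[OF this] obtain \<V> where spec: "\<forall>S. openin X S \<and> S \<noteq> {} \<and> S \<subseteq> S0 \<longrightarrow>
      countable (\<V> S) \<and> (\<forall>V\<in>\<V> S. openin X V \<and> V \<noteq> {} \<and> V \<subseteq> S) \<and> \<not> (\<exists>P Q. splits X (\<V> S) P Q)"
    by (elim exE)
  have \<V>: "countable (\<V> S)" "\<forall>V\<in>\<V> S. openin X V \<and> V \<noteq> {} \<and> V \<subseteq> S" "\<not> (\<exists>P Q. splits X (\<V> S) P Q)"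
    if "openin X S \<and> S \<noteq> {} \<and> S \<subseteq> S0" for S
    using spec[rule_format, OF that] by auto
  define stage where "stage = rec_nat {S0} (\<lambda>_ \<W>. \<Union>(\<V> ` \<W>))"
  have stage_simps: "stage 0 = {S0}" "stage (Suc n) = \<Union>(\<V> ` stage n)" for n
    by (simp_all add: stage_def)
  define \<W> where "\<W> = (\<Union>n. stage n)"
  have stage: "countable (stage n) \<and> (\<forall>S\<in>stage n. openin X S \<and> S \<noteq> {} \<and> S \<subseteq> S0)" for n
  proof (induction n)
    case 0
    then show ?case using S0 by (simp add: stage_simps)
  next
    case (Suc n)
    have "openin X V \<and> V \<noteq> {} \<and> V \<subseteq> S0" if "V \<in> \<V> S" "S \<in> stage n" for V S
    proof -
      have S: "openin X S \<and> S \<noteq> {} \<and> S \<subseteq> S0"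
        using Suc.IH that by blast
      then show ?thesis
        using \<V>(2)[OF S] that(1) by auto
    qed
    moreover have "countable (\<Union>(\<V> ` stage n))"
    proof (rule countable_UN)
      show "countable (stage n)"
        using Suc.IH by blast
      show "countable (\<V> S)" if "S \<in> stage n" for S
        using Suc.IH that \<V>(1) by blast
    qed
    ultimately show ?case
      unfolding stage_simps by blast
  qed
  have \<W>: "countable \<W>" "\<And>S. S \<in> \<W> \<Longrightarrow> openin X S \<and> S \<noteq> {} \<and> S \<subseteq> S0"
    unfolding \<W>_def using stage by auto
  have S0_in: "S0 \<in> \<W>"
    unfolding \<W>_def using stage_simps(1) by blast
  have closed_off: "\<V> S \<subseteq> \<W>" if S: "S \<in> \<W>" for S
  proof -
    from S obtain n where "S \<in> stage n"
      unfolding \<W>_def by blast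
    then have "\<V> S \<subseteq> stage (Suc n)"
      unfolding stage_simps by blast
    then show ?thesis
      unfolding \<W>_def by blast
  qed
  have "\<exists>N. openin X N \<and> x \<in> N \<and> (\<forall>S\<in>\<W>. \<not> S \<subseteq> N)" if "x \<in> X closure_of S0" for x
  proof -
    have "\<not> (\<forall>N. openin X N \<and> x \<in> N \<longrightarrow> (\<exists>S\<in>\<W>. S \<subseteq> N))"
    proof
      assume "\<forall>N. openin X N \<and> x \<in> N \<longrightarrow> (\<exists>S\<in>\<W>. S \<subseteq> N)"
      with \<W> have "countable_local_pi_base X x"
        unfolding countable_local_pi_base_def by (intro exI[of _ \<W>]) simp
      with no_pi that show False
        by blast
    qed
    then show ?thesis
      by blast
  qed
  then obtain N where N: "\<And>x. x \<in> X closure_of S0 \<Longrightarrow> openin X (N x) \<and> x \<in> N x \<and> (\<forall>S\<in>\<W>. \<not> S \<subseteq> N x)"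
    by metis
  have "compactin X (X closure_of S0)"
    by (simp add: X closedin_compact_space)
  then obtain \<F> where \<F>: "finite \<F>" "\<F> \<subseteq> N ` (X closure_of S0)" "X closure_of S0 \<subseteq> \<Union>\<F>"
    using compactinD[of X "X closure_of S0" "N ` (X closure_of S0)"] N by blast
  have \<F>_open: "openin X F" and \<F>_avoids: "\<And>S. S \<in> \<W> \<Longrightarrow> \<not> S \<subseteq> F" if "F \<in> \<F>" for F
    using \<F>(2) N that by auto
  define covers where "covers = (\<lambda>k. \<exists>S\<in>\<W>. \<exists>\<G>\<subseteq>\<F>. card \<G> = k \<and> X closure_of S \<subseteq> \<Union>\<G>)"
  have "covers (card \<F>)"
    unfolding covers_def using S0_in \<F>(3) by blast
  define k where "k = (LEAST k. covers k)"
  have k: "covers k" and k_min: "\<And>j. covers j \<Longrightarrow> k \<le> j"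
    unfolding k_def using \<open>covers (card \<F>)\<close> by (auto intro: LeastI Least_le)
  from k obtain S \<G> where S: "S \<in> \<W>" and \<G>: "\<G> \<subseteq> \<F>" "card \<G> = k" "X closure_of S \<subseteq> \<Union>\<G>"
    unfolding covers_def by blast
  have S': "openin X S" "S \<noteq> {}" "S \<subseteq> S0"
    using \<W> S by auto
  have S_cl: "S \<subseteq> X closure_of S"
    using S' openin_subset_closure_of by blast
  then have "\<G> \<noteq> {}"
    using S' \<G>(3) by auto
  then obtain B where B: "B \<in> \<G>"
    by blast
  have fin: "finite \<G>"
    using \<F>(1) \<G>(1) finite_subset by blast
  have "openin X B" "openin X (\<Union>(\<G> - {B}))"
    using \<F>_open \<G>(1) B by (auto intro!: openin_Union)
  moreover have "X closure_of S \<subseteq> \<Union>(\<G> - {B}) \<union> B"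
    using \<G>(3) by blast
  moreover have "V \<subseteq> S \<and> \<not> X closure_of V \<subseteq> \<Union>(\<G> - {B}) \<and> \<not> X closure_of V \<subseteq> B" if "V \<in> \<V> S" for V
  proof (intro conjI)
    have V: "V \<in> \<W>"
      using closed_off S that by blast
    show "V \<subseteq> S"
      using \<V>(2)[of S] S' that by blast
    show "\<not> X closure_of V \<subseteq> \<Union>(\<G> - {B})"
    proof
      assume "X closure_of V \<subseteq> \<Union>(\<G> - {B})"
      then have "covers (card (\<G> - {B}))"
        unfolding covers_def using V \<G>(1) by blast
      then have "k \<le> card (\<G> - {B})"
        by (rule k_min)
      then show False
        using \<G>(2) fin B by (metis card_Diff1_less not_le)
    qed
    have "V \<subseteq> X closure_of V"
      using V \<W>(2) openin_subset_closure_of by blast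
    then show "\<not> X closure_of V \<subseteq> B"
      using \<F>_avoids[of B V] \<G>(1) B V by blast
  qed
  ultimately have "\<exists>P Q. splits X (\<V> S) P Q"
    using splits_from_two_set_cover[OF normal S'(1)] by metis
  then show False
    using \<V>(3)[of S] S' by blast
qed

text \<open>The sets \<open>\<A>\<close> and \<open>\<B>\<close> consist of the pairs from which the first and the second component is chosen.
  The open set \<open>S\<close> is fixed so that all these intersections are among the sets to which
  \<open>countable_families_split_somewhere\<close> applies.\<close>
definition independent_pairs :: "'a topology \<Rightarrow> 'a set \<Rightarrow> ('a set \<times> 'a set) set \<Rightarrow> bool" where
  "independent_pairs X S \<I> \<longleftrightarrow>
     (\<forall>(P, Q)\<in>\<I>. openin X P \<and> openin X Q \<and> disjnt (X closure_of P) (X closure_of Q)) \<and>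
     (\<forall>\<A> \<B>. finite \<A> \<and> finite \<B> \<and> \<A> \<subseteq> \<I> \<and> \<B> \<subseteq> \<I> \<and> \<A> \<inter> \<B> = {} \<longrightarrow>
        S \<inter> \<Inter>(fst ` \<A>) \<inter> \<Inter>(snd ` \<B>) \<noteq> {})"

lemma independent_pairs_insert:
  assumes \<I>: "independent_pairs X S \<I>" and S: "openin X S" "S \<noteq> {}"
    and PQ: "splits X {S \<inter> \<Inter>(fst ` \<A>) \<inter> \<Inter>(snd ` \<B>) | \<A> \<B>. finite \<A> \<and> finite \<B> \<and> \<A> \<subseteq> \<I> \<and> \<B> \<subseteq> \<I> \<and> \<A> \<inter> \<B> = {}} P Q"
  shows "independent_pairs X S (insert (P, Q) \<I>)" "(P, Q) \<notin> \<I>"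
proof -
  have meets: "P \<inter> (S \<inter> \<Inter>(fst ` \<A>) \<inter> \<Inter>(snd ` \<B>)) \<noteq> {}" "Q \<inter> (S \<inter> \<Inter>(fst ` \<A>) \<inter> \<Inter>(snd ` \<B>)) \<noteq> {}"
    if "finite \<A>" "finite \<B>" "\<A> \<subseteq> \<I>" "\<B> \<subseteq> \<I>" "\<A> \<inter> \<B> = {}" for \<A> \<B>
    using PQ that unfolding splits_def by blast+
  have ops: "openin X P" "openin X Q" "disjnt (X closure_of P) (X closure_of Q)"
    using PQ unfolding splits_def by blast+
  then have "P \<inter> Q = {}"
    using openin_subset_closure_of[of X P] openin_subset_closure_of[of X Q] unfolding disjnt_def by blast
  with meets(2)[of "{(P, Q)}" "{}"] show "(P, Q) \<notin> \<I>"
    by auto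
  have "S \<inter> \<Inter>(fst ` \<A>) \<inter> \<Inter>(snd ` \<B>) \<noteq> {}"
    if AB: "finite \<A>" "finite \<B>" "\<A> \<subseteq> insert (P, Q) \<I>" "\<B> \<subseteq> insert (P, Q) \<I>" "\<A> \<inter> \<B> = {}" for \<A> \<B>
  proof -
    let ?A = "\<A> - {(P, Q)}" and ?B = "\<B> - {(P, Q)}"
    have *: "finite ?A" "finite ?B" "?A \<subseteq> \<I>" "?B \<subseteq> \<I>" "?A \<inter> ?B = {}"
      using AB by auto
    consider "(P, Q) \<in> \<A>" "(P, Q) \<notin> \<B>" | "(P, Q) \<notin> \<A>"
      using AB by blast
    then show ?thesis
    proof cases
      case 1
      then have "\<Inter>(fst ` \<A>) = P \<inter> \<Inter>(fst ` ?A)" "?B = \<B>"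
        by force+
      then show ?thesis
        using meets(1)[OF *] by auto
    next
      case 2
      have "Q \<inter> \<Inter>(snd ` ?B) \<subseteq> \<Inter>(snd ` \<B>)" "?A = \<A>"
        using 2 by force+
      then show ?thesis
        using meets(2)[OF *] by auto
    qed
  qed
  then show "independent_pairs X S (insert (P, Q) \<I>)"
    using \<I> ops unfolding independent_pairs_def by simp
qed

text \<open>A maximal independent family is uncountable: the finite intersections of a countable one form a
  countable family, and a pair that splits it could be added.\<close>
lemma uncountable_independent_pairs:
  assumes X: "compact_space X" "Hausdorff_space X"
    and S0: "openin X S0" "S0 \<noteq> {}"
    and no_pi: "\<forall>x \<in> X closure_of S0. \<not> countable_local_pi_base X x"
  obtains S \<I> where "openin X S" "independent_pairs X S \<I>" "uncountable \<I>"
proof -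
  obtain S where S: "openin X S" "S \<noteq> {}" and
    split: "\<forall>\<V>. countable \<V> \<and> (\<forall>V\<in>\<V>. openin X V \<and> V \<noteq> {} \<and> V \<subseteq> S) \<longrightarrow> (\<exists>P Q. splits X \<V> P Q)"
    using countable_families_split_somewhere[OF assms] by blast
  have "\<exists>\<I>\<in>Collect (independent_pairs X S). \<forall>\<J>\<in>Collect (independent_pairs X S). \<I> \<subseteq> \<J> \<longrightarrow> \<J> = \<I>"
  proof (rule subset_Zorn_nonempty)
    show "Collect (independent_pairs X S) \<noteq> {}"
      using S by (auto simp: independent_pairs_def intro!: exI[of _ "{}"])
    fix \<C> assume \<C>: "\<C> \<noteq> {}" "subset.chain (Collect (independent_pairs X S)) \<C>"
    then have ind: "independent_pairs X S \<I>" if "\<I> \<in> \<C>" for \<I>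
      using that by (auto simp: subset_chain_def)
    have "S \<inter> \<Inter>(fst ` \<A>) \<inter> \<Inter>(snd ` \<B>) \<noteq> {}"
      if AB: "finite \<A>" "finite \<B>" "\<A> \<subseteq> \<Union>\<C>" "\<B> \<subseteq> \<Union>\<C>" "\<A> \<inter> \<B> = {}" for \<A> \<B>
    proof -
      obtain \<I> where "\<I> \<in> \<C>" "\<A> \<union> \<B> \<subseteq> \<I>"
        using finite_subset_Union_chain[of "\<A> \<union> \<B>" \<C>] AB \<C> by (metis finite_UnI le_sup_iff)
      then show ?thesis
        using ind[of \<I>] AB unfolding independent_pairs_def by (meson le_sup_iff)
    qed
    moreover have "\<forall>(P, Q)\<in>\<Union>\<C>. openin X P \<and> openin X Q \<and> disjnt (X closure_of P) (X closure_of Q)"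
    proof
      fix p assume "p \<in> \<Union>\<C>"
      then obtain \<I> where "\<I> \<in> \<C>" "p \<in> \<I>"
        by blast
      then show "case p of (P, Q) \<Rightarrow> openin X P \<and> openin X Q \<and> disjnt (X closure_of P) (X closure_of Q)"
        using ind unfolding independent_pairs_def by blast
    qed
    ultimately show "\<Union>\<C> \<in> Collect (independent_pairs X S)"
      by (simp add: independent_pairs_def)
  qed
  then obtain \<I> where \<I>: "independent_pairs X S \<I>"
    and max: "\<And>\<J>. independent_pairs X S \<J> \<Longrightarrow> \<I> \<subseteq> \<J> \<Longrightarrow> \<J> = \<I>"
    by blast
  have "uncountable \<I>"
  proof
    assume "countable \<I>"
    define \<V> where "\<V> = {S \<inter> \<Inter>(fst ` \<A>) \<inter> \<Inter>(snd ` \<B>) | \<A> \<B>. finite \<A> \<and> finite \<B> \<and> \<A> \<subseteq> \<I> \<and> \<B> \<subseteq> \<I> \<and> \<A> \<inter> \<B> = {}}"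
    have "\<V> \<subseteq> (\<lambda>(\<A>, \<B>). S \<inter> \<Inter>(fst ` \<A>) \<inter> \<Inter>(snd ` \<B>)) ` ({\<A>. finite \<A> \<and> \<A> \<subseteq> \<I>} \<times> {\<B>. finite \<B> \<and> \<B> \<subseteq> \<I>})"
      unfolding \<V>_def by auto
    then have count: "countable \<V>"
      by (rule countable_subset)
        (intro countable_image countable_SIGMA countable_Collect_finite_subset \<open>countable \<I>\<close>)
    have "openin X V \<and> V \<noteq> {} \<and> V \<subseteq> S" if V_in: "V \<in> \<V>" for V
    proof -
      obtain \<A> \<B> where V: "V = S \<inter> \<Inter>(fst ` \<A>) \<inter> \<Inter>(snd ` \<B>)"
        and AB: "finite \<A>" "finite \<B>" "\<A> \<subseteq> \<I>" "\<B> \<subseteq> \<I>" "\<A> \<inter> \<B> = {}"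
        using V_in unfolding \<V>_def by blast
      have "\<And>U. U \<in> fst ` \<A> \<Longrightarrow> openin X U" "\<And>U. U \<in> snd ` \<B> \<Longrightarrow> openin X U"
        using AB \<I> unfolding independent_pairs_def by fastforce+
      then have "openin X V"
        unfolding V using AB S by (metis finite_imageI openin_Int_Inter)
      moreover have "V \<noteq> {}"
        unfolding V using \<I>[unfolded independent_pairs_def, THEN conjunct2, rule_format, of \<A> \<B>] AB by blast
      ultimately show ?thesis
        unfolding V by blast
    qed
    with count split[THEN spec, of \<V>] obtain P Q where PQ: "splits X \<V> P Q"
      by (elim impE exE) simp_all
    note insert = independent_pairs_insert[OF \<I> S PQ[unfolded \<V>_def]]
    have "insert (P, Q) \<I> = \<I>"
      using insert(1) by (rule max) blast
    with insert(2) show False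
      by blast
  qed
  then show thesis
    using S \<I> that by blast
qed

section \<open>Maps onto the Tychonoff cube\<close>

lemma binary_expansion:
  fixes t :: real
  assumes "0 \<le> t" "t \<le> 1"
  shows "\<exists>b :: nat \<Rightarrow> real. range b \<subseteq> {0, 1} \<and> (\<lambda>n. b n / 2 ^ Suc n) sums t"
proof -
  \<comment> \<open>\<open>r n\<close> is the remainder after \<open>n\<close> digits, scaled by \<open>2 ^ n\<close> to stay in the unit interval.\<close>
  define r where "r = rec_nat t (\<lambda>_ r. if r \<ge> 1/2 then 2 * r - 1 else 2 * r)"
  have r_simps: "r 0 = t" "r (Suc n) = (if r n \<ge> 1/2 then 2 * r n - 1 else 2 * r n)" for n
    by (simp_all add: r_def)
  have r: "0 \<le> r n \<and> r n \<le> 1" for n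
    by (induction n) (use assms in \<open>auto simp: r_simps\<close>)
  define b :: "nat \<Rightarrow> real" where "b = (\<lambda>n. if r n \<ge> 1/2 then 1 else 0)"
  have partial: "(\<Sum>k<n. b k / 2 ^ Suc k) = t - r n / 2 ^ n" for n
    by (induction n) (auto simp: r_simps b_def field_simps)
  have "(\<lambda>n. r n / 2 ^ n) \<longlonglongrightarrow> 0"
  proof (rule tendsto_sandwich)
    show "\<forall>\<^sub>F n in sequentially. 0 \<le> r n / 2 ^ n" "\<forall>\<^sub>F n in sequentially. r n / 2 ^ n \<le> (1 / 2) ^ n"
      using r by (auto simp: power_one_over divide_simps)
    show "(\<lambda>n. (1 / 2) ^ n :: real) \<longlonglongrightarrow> 0"
      by (simp add: LIMSEQ_power_zero)
  qed simp
  then have "(\<lambda>n. t - r n / 2 ^ n) \<longlonglongrightarrow> t - 0"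
    by (intro tendsto_diff tendsto_const)
  then have "(\<lambda>n. b n / 2 ^ Suc n) sums t"
    unfolding sums_def partial by simp
  moreover have "range b \<subseteq> {0, 1}"
    by (auto simp: b_def)
  ultimately show ?thesis
    by blast
qed

lemma binary_series_bounds:
  fixes c :: "nat \<Rightarrow> real"
  assumes "\<And>n. c n \<in> {0..1}"
  shows "summable (\<lambda>n. c n / 2 ^ Suc n)" "(\<Sum>n. c n / 2 ^ Suc n) \<in> {0..1}"
    "\<bar>(\<Sum>n. c n / 2 ^ Suc n) - (\<Sum>n<k. c n / 2 ^ Suc n)\<bar> \<le> (1/2) ^ k"
proof -
  let ?g = "\<lambda>n. (1/2) ^ Suc n :: real"
  have g: "?g sums 1"
    by (rule power_half_series)
  have c: "0 \<le> c n" "c n \<le> 1" for n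
    using assms[of n] by auto
  have le: "c n / 2 ^ Suc n \<le> ?g n" for n
    using c[of n] by (simp add: power_one_over divide_simps)
  have nn: "0 \<le> c n / 2 ^ Suc n" for n
    using c[of n] by simp
  show sm: "summable (\<lambda>n. c n / 2 ^ Suc n)"
  proof (rule summable_comparison_test'[OF sums_summable[OF g]])
    show "norm (c n / 2 ^ Suc n) \<le> ?g n" if "n \<ge> 0" for n
      unfolding real_norm_def abs_of_nonneg[OF nn] by (rule le)
  qed
  have "(\<Sum>n. c n / 2 ^ Suc n) \<le> suminf ?g"
    by (intro suminf_le le sm sums_summable[OF g])
  then show "(\<Sum>n. c n / 2 ^ Suc n) \<in> {0..1}"
    using suminf_nonneg[OF sm nn] sums_unique[OF g] by simp
  have tail: "(\<lambda>n. ?g (n + k)) sums (1/2) ^ k"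
    using sums_mult[OF g, of "(1/2) ^ k"] by (simp add: power_add mult.commute)
  have sk: "summable (\<lambda>n. c (n + k) / 2 ^ Suc (n + k))"
    using summable_iff_shift[of "\<lambda>n. c n / 2 ^ Suc n" k] sm by simp
  have "(\<Sum>n. c (n + k) / 2 ^ Suc (n + k)) \<le> (1/2) ^ k"
    using suminf_le[OF le sk sums_summable[OF tail]] sums_unique[OF tail] by simp
  moreover have "0 \<le> (\<Sum>n. c (n + k) / 2 ^ Suc (n + k))"
    using suminf_nonneg[OF sk] nn by blast
  ultimately show "\<bar>(\<Sum>n. c n / 2 ^ Suc n) - (\<Sum>n<k. c n / 2 ^ Suc n)\<bar> \<le> (1/2) ^ k"
    using suminf_split_initial_segment[OF sm, of k] by simp
qed

text \<open>The digits are allowed to be real, since a continuous function on \<open>X\<close> need not take only the values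
  \<open>0\<close> and \<open>1\<close>; the partial sums converge uniformly.\<close>
lemma continuous_map_binary_series:
  assumes f: "\<And>n. continuous_map X (top_of_set {0..1::real}) (f n)"
  shows "continuous_map X (top_of_set {0..1}) (\<lambda>x. \<Sum>n. f n x / 2 ^ Suc n)"
proof -
  have f01: "f n x \<in> {0..1}" if "x \<in> topspace X" for n x
    using f[of n] that by (auto simp: continuous_map_in_subtopology)
  have cont: "continuous_map X euclideanreal (f n)" for n
    using f continuous_map_in_subtopology by blast
  have "continuous_map X Met_TC.mtopology (\<lambda>x. \<Sum>n. f n x / 2 ^ Suc n)"
  proof (rule Met_TC.continuous_map_uniform_limit)
    show "\<forall>\<^sub>F k in sequentially. continuous_map X Met_TC.mtopology (\<lambda>x. \<Sum>n<k. f n x / 2 ^ Suc n)"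
      using cont by (intro always_eventually allI) (simp, intro continuous_intros; simp)
    show "\<forall>\<^sub>F k in sequentially. \<forall>x\<in>topspace X. (\<Sum>n. f n x / 2 ^ Suc n) \<in> UNIV \<and>
            dist (\<Sum>n<k. f n x / 2 ^ Suc n) (\<Sum>n. f n x / 2 ^ Suc n) < \<epsilon>" if "0 < \<epsilon>" for \<epsilon>
    proof -
      have "(\<lambda>k. (1/2::real) ^ k) \<longlonglongrightarrow> 0"
        by (simp add: LIMSEQ_power_zero)
      then have "\<forall>\<^sub>F k in sequentially. (1/2::real) ^ k < \<epsilon>"
        using that by (rule order_tendstoD)
      then show ?thesis
      proof (rule eventually_mono)
        fix k assume k: "(1/2::real) ^ k < \<epsilon>"
        show "\<forall>x\<in>topspace X. (\<Sum>n. f n x / 2 ^ Suc n) \<in> UNIV \<and>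
            dist (\<Sum>n<k. f n x / 2 ^ Suc n) (\<Sum>n. f n x / 2 ^ Suc n) < \<epsilon>"
        proof (intro ballI conjI UNIV_I)
          fix x assume "x \<in> topspace X"
          then have "\<bar>(\<Sum>n. f n x / 2 ^ Suc n) - (\<Sum>n<k. f n x / 2 ^ Suc n)\<bar> \<le> (1/2) ^ k"
            by (intro binary_series_bounds(3) f01)
          then show "dist (\<Sum>n<k. f n x / 2 ^ Suc n) (\<Sum>n. f n x / 2 ^ Suc n) < \<epsilon>"
            unfolding dist_real_def abs_minus_commute[of "\<Sum>n<k. f n x / 2 ^ Suc n"] using k by linarith
        qed
      qed
    qed
  qed simp
  then show ?thesis
    using binary_series_bounds(2)[OF f01] by (simp add: continuous_map_in_subtopology)
qed

text \<open>Urysohn functions for the pairs map \<open>X\<close> to a cube so that the image contains all of the vertices.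
  Grouping the functions into countable blocks and reading each block as a sequence of binary digits
  turns the vertices into all points of the cube of weight \<open>\<omega>\<^sub>1\<close>.\<close>
lemma independent_pairs_maps_onto_cube:
  includes cardinal_syntax
  assumes X: "compact_space X" "Hausdorff_space X"
    and S: "openin X S"
    and \<I>: "independent_pairs X S \<I>" "uncountable \<I>"
  shows "continuously_maps_onto X Tychonoff_cube_omega_1"
proof -
  have "normal_space X"
    using X compact_Hausdorff_or_regular_imp_normal_space by blast
  have pairs: "openin X (fst p) \<and> openin X (snd p) \<and> disjnt (X closure_of fst p) (X closure_of snd p)"
    if "p \<in> \<I>" for p
    using \<I>(1) that unfolding independent_pairs_def by auto
  have "\<exists>f. continuous_map X (top_of_set {0..1::real}) f \<and>
      f ` (X closure_of fst p) \<subseteq> {0} \<and> f ` (X closure_of snd p) \<subseteq> {1}" if "p \<in> \<I>" for p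
    using Urysohn_lemma[OF \<open>normal_space X\<close>, of "X closure_of fst p" "X closure_of snd p" 0 1] pairs[OF that]
    by (metis closedin_closure_of zero_le_one)
  then obtain f where f: "\<And>p. p \<in> \<I> \<Longrightarrow> continuous_map X (top_of_set {0..1::real}) (f p) \<and>
      f p ` (X closure_of fst p) \<subseteq> {0} \<and> f p ` (X closure_of snd p) \<subseteq> {1}"
    by metis
  \<comment> \<open>By compactness, independence prescribes the values of all \<open>f p\<close> at once.\<close>
  have prescribe: "\<exists>x\<in>topspace X. \<forall>p\<in>\<I>. f p x = (if p \<in> E then 1 else 0)" for E
  proof -
    define C where "C = (\<lambda>p. X closure_of (if p \<in> E then snd p else fst p))"
    \<comment> \<open>The whole space is a member so that the intersection visibly lies in \<open>X\<close>.\<close>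
    define \<U> where "\<U> = insert (topspace X) (C ` \<I>)"
    have "\<Inter>\<F> \<noteq> {}" if \<F>: "finite \<F>" "\<F> \<subseteq> \<U>" for \<F>
    proof -
      have "finite (\<F> - {topspace X})" "\<F> - {topspace X} \<subseteq> C ` \<I>"
        using \<F> unfolding \<U>_def by auto
      then obtain \<A> where \<A>: "finite \<A>" "\<A> \<subseteq> \<I>" "\<F> - {topspace X} = C ` \<A>"
        by (meson finite_subset_image)
      then have "S \<inter> \<Inter>(fst ` (\<A> - E)) \<inter> \<Inter>(snd ` (\<A> \<inter> E)) \<noteq> {}"
        using \<I>(1)[unfolded independent_pairs_def, THEN conjunct2, rule_format, of "\<A> - E" "\<A> \<inter> E"]
        by blast
      then obtain x where x: "x \<in> S" "\<And>p. p \<in> \<A> - E \<Longrightarrow> x \<in> fst p" "\<And>p. p \<in> \<A> \<inter> E \<Longrightarrow> x \<in> snd p"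
        by auto
      have "x \<in> C p" if "p \<in> \<A>" for p
      proof -
        have "fst p \<subseteq> X closure_of fst p" "snd p \<subseteq> X closure_of snd p"
          using pairs \<A>(2) that openin_subset_closure_of by blast+
        then show ?thesis
          using x(2)[of p] x(3)[of p] that unfolding C_def by (cases "p \<in> E") auto
      qed
      moreover have "x \<in> topspace X"
        using x(1) S openin_subset by blast
      ultimately have "x \<in> \<Inter>\<F>"
        using \<A>(3) by blast
      then show ?thesis
        by blast
    qed
    moreover have "closedin X D" if "D \<in> \<U>" for D
      using that unfolding \<U>_def C_def by auto
    ultimately have "\<Inter>\<U> \<noteq> {}"
      using X(1)[unfolded compact_space_fip, THEN spec, of \<U>] by simp
    then obtain x where x: "x \<in> topspace X" "\<And>p. p \<in> \<I> \<Longrightarrow> x \<in> C p"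
      unfolding \<U>_def by auto
    have "f p x = (if p \<in> E then 1 else 0)" if "p \<in> \<I>" for p
      using f[OF that] x(2)[OF that] unfolding C_def by (auto split: if_splits)
    with x(1) show ?thesis
      by blast
  qed
  \<comment> \<open>Countably many coordinates in \<open>{0, 1}\<close> are spent on each coordinate of the cube.\<close>
  have "infinite \<I>"
    using \<I>(2) uncountable_infinite by blast
  have "Card_order (cardSuc natLeq)"
    by (simp add: cardSuc_Card_order natLeq_Card_order)
  have "\<not> |\<I>| \<le>o |UNIV :: nat set|"
  proof
    assume "|\<I>| \<le>o |UNIV :: nat set|"
    then obtain e :: "_ \<Rightarrow> nat" where "inj_on e \<I>"
      unfolding card_of_ordLeq[symmetric] by blast
    with \<I>(2) show False
      using countableI by blast
  qed
  then have "|UNIV :: nat set| <o |\<I>|"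
    using not_ordLeq_iff_ordLess[OF card_of_Well_order card_of_Well_order] by blast
  then have "natLeq <o |\<I>|"
    by (rule ordIso_ordLess_trans[OF ordIso_symmetric[OF card_of_nat]])
  then have "cardSuc natLeq \<le>o |\<I>|"
    by (intro cardSuc_least natLeq_Card_order card_of_Card_order)
  then have "|omega_1| \<le>o |\<I>|"
    unfolding omega_1_def using card_of_Field_ordIso[OF \<open>Card_order (cardSuc natLeq)\<close>] ordIso_ordLeq_trans by blast
  moreover have "|UNIV :: nat set| \<le>o |\<I>|"
    using \<open>infinite \<I>\<close> infinite_iff_card_of_nat by blast
  ultimately have "|omega_1 \<times> (UNIV :: nat set)| \<le>o |\<I>|"
    using \<open>infinite \<I>\<close> by (intro card_of_Times_ordLeq_infinite_Field card_of_Card_order) (simp_all add: Field_card_of)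
  then obtain h where h: "inj_on h (omega_1 \<times> (UNIV :: nat set))" "h ` (omega_1 \<times> UNIV) \<subseteq> \<I>"
    unfolding card_of_ordLeq[symmetric] by blast
  have h_in: "h (\<alpha>, n) \<in> \<I>" if "\<alpha> \<in> omega_1" for \<alpha> n
    using h(2) that by blast
  define g where "g = (\<lambda>x. \<lambda>\<alpha>\<in>omega_1. \<Sum>n. f (h (\<alpha>, n)) x / 2 ^ Suc n)"
  have "continuous_map X Tychonoff_cube_omega_1 g"
    unfolding Tychonoff_cube_omega_1_def continuous_map_componentwise
  proof (intro conjI ballI)
    show "g ` topspace X \<subseteq> extensional omega_1"
      by (auto simp: g_def)
    fix \<alpha> assume \<alpha>: "\<alpha> \<in> omega_1"
    have "continuous_map X (top_of_set {0..1}) (\<lambda>x. \<Sum>n. f (h (\<alpha>, n)) x / 2 ^ Suc n)"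
      using f[OF h_in[OF \<alpha>]] by (intro continuous_map_binary_series) blast
    then show "continuous_map X (top_of_set {0..1}) (\<lambda>x. g x \<alpha>)"
      using \<alpha> by (simp add: g_def)
  qed
  moreover have "t \<in> g ` topspace X" if "t \<in> topspace Tychonoff_cube_omega_1" for t
  proof -
    have t: "t \<in> extensional omega_1" "\<And>\<alpha>. \<alpha> \<in> omega_1 \<Longrightarrow> 0 \<le> t \<alpha> \<and> t \<alpha> \<le> 1"
      using that unfolding Tychonoff_cube_omega_1_def by (auto simp: PiE_iff)
    have "\<exists>b :: nat \<Rightarrow> real. range b \<subseteq> {0, 1} \<and> (\<lambda>n. b n / 2 ^ Suc n) sums t \<alpha>" if "\<alpha> \<in> omega_1" for \<alpha>
      using binary_expansion[of "t \<alpha>"] t(2)[OF that] by simp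
    then obtain b :: "nat set \<Rightarrow> nat \<Rightarrow> real" where
      b: "\<And>\<alpha>. \<alpha> \<in> omega_1 \<Longrightarrow> range (b \<alpha>) \<subseteq> {0, 1} \<and> (\<lambda>n. b \<alpha> n / 2 ^ Suc n) sums t \<alpha>"
      by metis
    obtain x where x: "x \<in> topspace X" and
      fx: "\<And>p. p \<in> \<I> \<Longrightarrow> f p x = (if p \<in> h ` {(\<alpha>, n). \<alpha> \<in> omega_1 \<and> b \<alpha> n = 1} then 1 else 0)"
      using prescribe by meson
    have "f (h (\<alpha>, n)) x = b \<alpha> n" if \<alpha>: "\<alpha> \<in> omega_1" for \<alpha> n
    proof -
      have "h (\<alpha>, n) \<in> h ` {(\<alpha>, n). \<alpha> \<in> omega_1 \<and> b \<alpha> n = 1} \<longleftrightarrow> b \<alpha> n = 1"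
        using inj_on_image_mem_iff[OF h(1), of "(\<alpha>, n)" "{(\<alpha>, n). \<alpha> \<in> omega_1 \<and> b \<alpha> n = 1}"] \<alpha> by auto
      moreover have "b \<alpha> n \<in> {0, 1}"
        using b[OF \<alpha>] by blast
      ultimately show ?thesis
        using fx[OF h_in[OF \<alpha>]] by auto
    qed
    then have "g x \<alpha> = t \<alpha>" if "\<alpha> \<in> omega_1" for \<alpha>
      using b[OF that] that by (simp add: g_def sums_iff)
    then have "g x = t"
      using t(1) by (intro extensionalityI[of _ omega_1]) (simp_all add: g_def)
    with x show ?thesis
      by blast
  qed
  ultimately show ?thesis
    unfolding continuously_maps_onto_def
    using continuous_map_image_subset_topspace[of X Tychonoff_cube_omega_1 g]
    by (intro exI[of _ g]) blast
qed

lemma regular_space_shrink: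
  assumes "regular_space X" "openin X U" "y \<in> U"
  obtains W where "openin X W" "y \<in> W" "X closure_of W \<subseteq> U"
proof -
  have "neighbourhood_base_of (closedin X) X"
    using assms(1) neighbourhood_base_of_closedin by blast
  then obtain W C where "openin X W" "closedin X C" "y \<in> W" "W \<subseteq> C" "C \<subseteq> U"
    using assms(2,3) unfolding neighbourhood_base_of by metis
  then show thesis
    using that[of W] closure_of_minimal[of W C X] by auto
qed

text \<open>This is the case \<open>\<omega>\<^sub>1\<close> of Shapirovskii's theorem, with the hypothesis imposed on an open set. It passes to
  an open \<open>W\<close> with closure in \<open>U\<close> because the compactness argument needs a closed set of points without
  countable local \<open>\<pi>\<close>-bases.\<close>
theorem Shapirovskii_omega_1:
  assumes X: "compact_space X" "Hausdorff_space X"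
    and U: "openin X U" "U \<noteq> {}"
    and no_pi: "\<forall>x\<in>U. \<not> countable_local_pi_base X x"
  shows "continuously_maps_onto X Tychonoff_cube_omega_1"
proof -
  obtain y where "y \<in> U"
    using U(2) by blast
  then obtain W where W: "openin X W" "y \<in> W" "X closure_of W \<subseteq> U"
    using regular_space_shrink[OF _ U(1)] X compact_Hausdorff_imp_regular_space by blast
  have "\<forall>x\<in>X closure_of W. \<not> countable_local_pi_base X x"
    using W(3) no_pi by blast
  moreover have "W \<noteq> {}"
    using W(2) by blast
  ultimately obtain S \<I> where "openin X S" "independent_pairs X S \<I>" "uncountable \<I>"
    using uncountable_independent_pairs[OF X W(1)] by metis
  then show ?thesis
    using independent_pairs_maps_onto_cube[OF X] by blast
qed

section \<open>Metrizability of topological groups\<close>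

text \<open>The middle element \<open>z\<close> is the one at which the running sum reaches \<open>c\<close>; with \<open>c\<close> half of the total,
  neither side exceeds half of the total.\<close>
lemma split_list_at_weight:
  fixes f :: "'a \<Rightarrow> real"
  assumes "\<And>x. 0 \<le> f x" "0 \<le> c" "xs \<noteq> []"
  shows "\<exists>ys z zs. xs = ys @ z # zs \<and> sum_list (map f ys) \<le> c \<and>
           (c \<le> sum_list (map f ys) + f z \<or> zs = [])"
  using assms(2,3)
proof (induction xs arbitrary: c)
  case (Cons x xs)
  show ?case
  proof (cases "c \<le> f x \<or> xs = []")
    case True
    then have "x # xs = [] @ x # xs \<and> sum_list (map f []) \<le> c \<and> (c \<le> sum_list (map f []) + f x \<or> xs = [])"
      using Cons.prems by auto
    then show ?thesis
      by blast
  next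
    case False
    then obtain ys z zs where "xs = ys @ z # zs" "sum_list (map f ys) \<le> c - f x"
      "c - f x \<le> sum_list (map f ys) + f z \<or> zs = []"
      using Cons.IH[of "c - f x"] by auto
    then have "x # xs = (x # ys) @ z # zs \<and> sum_list (map f (x # ys)) \<le> c \<and>
        (c \<le> sum_list (map f (x # ys)) + f z \<or> zs = [])"
      by auto
    then show ?thesis
      by blast
  qed
qed simp

context group
begin

abbreviation list_product :: "'a list \<Rightarrow> 'a" where
  "list_product xs \<equiv> foldr (\<otimes>) xs \<one>"

lemma list_product_closed: "set xs \<subseteq> carrier G \<Longrightarrow> list_product xs \<in> carrier G"
  by (induction xs) auto

lemma list_product_append:
  "set xs \<subseteq> carrier G \<Longrightarrow> set ys \<subseteq> carrier G \<Longrightarrow>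
     list_product (xs @ ys) = list_product xs \<otimes> list_product ys"
  by (induction xs) (auto simp: m_assoc list_product_closed)

lemma list_product_rev_inv:
  "set xs \<subseteq> carrier G \<Longrightarrow> list_product (rev (map (\<lambda>x. inv x) xs)) = inv (list_product xs)"
proof (induction xs)
  case (Cons x xs)
  then have "list_product (rev (map (\<lambda>x. inv x) xs) @ [inv x]) = inv (list_product xs) \<otimes> inv x"
    by (subst list_product_append) auto
  with Cons show ?case
    by (simp add: inv_mult_group list_product_closed)
qed simp

text \<open>The weight \<open>w x\<close> is the infimum of the \<open>1 / 2 ^ n\<close> with \<open>x\<close> in \<open>V n\<close>, and the norm is the infimum of the
  total weights of the factorizations of \<open>x\<close>. Subadditivity and symmetry then come for free; the point
  is that the infimum is still large outside \<open>V n\<close>.\<close>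
lemma chain_norm_exists:
  fixes V :: "nat \<Rightarrow> 'a set"
  assumes V0: "V 0 = carrier G" and V1: "\<And>n. \<one> \<in> V n"
    and V_inv: "\<And>n x. x \<in> V n \<Longrightarrow> inv x \<in> V n"
    and V_sub: "\<And>n. V (Suc n) \<subseteq> V n"
    and V_cube: "\<And>n a b c. a \<in> V (Suc n) \<Longrightarrow> b \<in> V (Suc n) \<Longrightarrow> c \<in> V (Suc n) \<Longrightarrow> a \<otimes> b \<otimes> c \<in> V n"
  shows "\<exists>N :: 'a \<Rightarrow> real. N \<one> = 0 \<and>
    (\<forall>x\<in>carrier G. 0 \<le> N x \<and> N (inv x) = N x) \<and>
    (\<forall>x\<in>carrier G. \<forall>y\<in>carrier G. N (x \<otimes> y) \<le> N x + N y) \<and>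
    (\<forall>x\<in>carrier G. \<forall>n. (N x < 1 / 2 ^ n \<longrightarrow> x \<in> V n) \<and> (x \<in> V n \<longrightarrow> N x \<le> 1 / 2 ^ n))"
proof -
  have antimono: "V n \<subseteq> V m" if "m \<le> n" for m n
    using that V_sub by (rule lift_Suc_antimono_le[rotated])
  have V_carrier: "V n \<subseteq> carrier G" for n
    using antimono[of 0 n] V0 by simp
  define w :: "'a \<Rightarrow> real" where "w = (\<lambda>x. Inf {1 / 2 ^ n | n. x \<in> V n})"
  have bdd_w: "bdd_below {1 / 2 ^ n :: real | n. x \<in> V n}" for x
    by (rule bdd_belowI[of _ 0]) auto
  have w_le: "w x \<le> 1 / 2 ^ n" if "x \<in> V n" for x n
    unfolding w_def using that by (intro cInf_lower bdd_w) blast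
  have w_less: "x \<in> V (Suc n)" if "w x < 1 / 2 ^ n" "x \<in> carrier G" for x n
  proof -
    have "{1 / 2 ^ n :: real | n. x \<in> V n} \<noteq> {}"
      using that(2) V0 by blast
    from cInf_lessD[OF this that(1)[unfolded w_def]]
    obtain m where m: "x \<in> V m" "1 / 2 ^ m < (1 / 2 ^ n :: real)"
      by blast
    then have "n < m"
      by (simp add: divide_simps)
    then show ?thesis
      using antimono[of "Suc n" m] m(1) by auto
  qed
  have w_inv: "w (inv x) = w x" if "x \<in> carrier G" for x
  proof -
    have "inv x \<in> V n \<longleftrightarrow> x \<in> V n" for n
      using V_inv[of x n] V_inv[of "inv x" n] that by auto
    then show ?thesis
      by (simp add: w_def)
  qed
  \<comment> \<open>Outside the carrier \<open>w\<close> is an infimum over the empty set; \<open>v\<close> is nonnegative everywhere.\<close>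
  define v where "v = (\<lambda>x. \<bar>w x\<bar>)"
  have w_nonneg: "0 \<le> w x" if "x \<in> carrier G" for x
    unfolding w_def using that V0 by (intro cInf_greatest) auto
  have v_eq: "v x = w x" if "x \<in> carrier G" for x
    using w_nonneg[OF that] by (simp add: v_def)
  have v_nonneg: "0 \<le> v x" for x
    by (simp add: v_def)
  let ?s = "\<lambda>xs. sum_list (map v xs)"
  have s_nonneg: "0 \<le> ?s xs" for xs
    by (intro sum_list_nonneg) (auto simp: v_nonneg)
  \<comment> \<open>A chain of total weight below \<open>1 / 2 ^ n\<close> splits into a middle element and two parts of at
    most half the weight, which is why the cube of \<open>V (Suc n)\<close> is required to lie in \<open>V n\<close>.\<close>
  have chain: "list_product xs \<in> V n" if "set xs \<subseteq> carrier G" "?s xs < 1 / 2 ^ n" for xs n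
    using that
  proof (induction xs arbitrary: n rule: length_induct)
    case (1 xs)
    show ?case
    proof (cases "xs = []")
      case True
      then show ?thesis using V1 by simp
    next
      case False
      have "0 \<le> ?s xs / 2"
        using s_nonneg by simp
      from split_list_at_weight[of v, OF v_nonneg this False]
      obtain ys z zs where xs: "xs = ys @ z # zs" and ys: "?s ys \<le> ?s xs / 2"
        and z: "?s xs / 2 \<le> ?s ys + v z \<or> zs = []"
        by blast
      have total: "?s xs = ?s ys + v z + ?s zs"
        by (simp add: xs)
      have half: "?s xs / 2 < 1 / 2 ^ Suc n"
        using 1(3) by simp
      have zs: "?s zs \<le> ?s xs / 2"
        using z s_nonneg[of xs] unfolding total by auto
      have carr: "set ys \<subseteq> carrier G" "z \<in> carrier G" "set zs \<subseteq> carrier G"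
        using 1(2) by (auto simp: xs)
      have "list_product ys \<in> V (Suc n)"
        using 1(1)[rule_format, of ys "Suc n"] carr(1) ys half by (simp add: xs)
      moreover have "list_product zs \<in> V (Suc n)"
        using 1(1)[rule_format, of zs "Suc n"] carr(3) zs half by (simp add: xs)
      moreover have "w z < 1 / 2 ^ n"
        using total s_nonneg[of ys] s_nonneg[of zs] 1(3) v_eq[OF carr(2)] by linarith
      then have "z \<in> V (Suc n)"
        using w_less carr(2) by blast
      ultimately have "list_product ys \<otimes> z \<otimes> list_product zs \<in> V n"
        using V_cube by blast
      moreover have "list_product xs = list_product ys \<otimes> z \<otimes> list_product zs"
        using list_product_append[of ys "z # zs"] carr
        by (simp add: xs m_assoc list_product_closed del: foldr_append)
      ultimately show ?thesis
        by simp
    qed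
  qed
  define C where "C = (\<lambda>x. {?s xs | xs. set xs \<subseteq> carrier G \<and> list_product xs = x})"
  define N where "N = (\<lambda>x. Inf (C x))"
  have bdd: "bdd_below (C x)" for x
    by (rule bdd_belowI[of _ 0]) (auto simp: C_def s_nonneg)
  have C_single: "v x \<in> C x" if "x \<in> carrier G" for x
    unfolding C_def using that by (intro CollectI exI[of _ "[x]"]) auto
  have N_le: "N x \<le> ?s xs" if "set xs \<subseteq> carrier G" "list_product xs = x" for x xs
    unfolding N_def using that by (intro cInf_lower bdd) (auto simp: C_def)
  have N_less: "\<exists>xs. set xs \<subseteq> carrier G \<and> list_product xs = x \<and> ?s xs < c"
    if "x \<in> carrier G" "N x < c" for x c
  proof -
    have "C x \<noteq> {}"
      using C_single[OF that(1)] by blast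
    from cInf_lessD[OF this that(2)[unfolded N_def]] show ?thesis
      unfolding C_def by blast
  qed
  have N_nonneg: "0 \<le> N x" if "x \<in> carrier G" for x
    unfolding N_def using C_single[OF that] by (intro cInf_greatest) (auto simp: C_def s_nonneg)
  have N_inv_le: "N (inv x) \<le> N x" if x: "x \<in> carrier G" for x
  proof (rule field_le_epsilon)
    fix e :: real assume "0 < e"
    then obtain xs where xs: "set xs \<subseteq> carrier G" "list_product xs = x" "?s xs < N x + e"
      using N_less[OF x, of "N x + e"] by auto
    have "map v (map (\<lambda>x. inv x) xs) = map v xs"
      using xs(1) w_inv v_eq by (induction xs) auto
    then have "?s (rev (map (\<lambda>x. inv x) xs)) = ?s xs"
      by (simp only: rev_map[symmetric] sum_list_rev)
    moreover have "N (inv x) \<le> ?s (rev (map (\<lambda>x. inv x) xs))"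
      using xs list_product_rev_inv[OF xs(1)] by (intro N_le) auto
    ultimately show "N (inv x) \<le> N x + e"
      using xs(3) by linarith
  qed
  have "N \<one> = 0"
    using N_le[of "[]" \<one>] N_nonneg[of \<one>] by simp
  moreover have "N (inv x) = N x" if "x \<in> carrier G" for x
    using N_inv_le[OF that] N_inv_le[of "inv x"] that by simp
  moreover have "N (x \<otimes> y) \<le> N x + N y" if x: "x \<in> carrier G" and y: "y \<in> carrier G" for x y
  proof (rule field_le_epsilon)
    fix e :: real assume "0 < e"
    then obtain xs ys where xs: "set xs \<subseteq> carrier G" "list_product xs = x" "?s xs < N x + e / 2"
      and ys: "set ys \<subseteq> carrier G" "list_product ys = y" "?s ys < N y + e / 2"
      using N_less[OF x, of "N x + e / 2"] N_less[OF y, of "N y + e / 2"] by auto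
    have "N (x \<otimes> y) \<le> ?s (xs @ ys)"
      using xs ys list_product_append by (intro N_le) auto
    then show "N (x \<otimes> y) \<le> N x + N y + e"
      using xs(3) ys(3) by simp
  qed
  moreover have "x \<in> V n" if "x \<in> carrier G" "N x < 1 / 2 ^ n" for x n
    using N_less[OF that] chain by blast
  moreover have "N x \<le> 1 / 2 ^ n" if "x \<in> V n" for x n
  proof -
    have x: "x \<in> carrier G"
      using V_carrier that by blast
    then show ?thesis
      using N_le[of "[x]" x] w_le[OF that] v_eq[OF x] by simp
  qed
  ultimately show ?thesis
    using N_nonneg by (intro exI[of _ N] conjI ballI allI impI) simp_all
qed

end

lemma topological_group_mult_nbhd:
  fixes G (structure)
  assumes "topological_group G T" "a \<in> carrier G" "b \<in> carrier G" "openin T W" "a \<otimes> b \<in> W"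
  obtains A B where "openin T A" "openin T B" "a \<in> A" "b \<in> B"
    "\<And>x y. x \<in> A \<Longrightarrow> y \<in> B \<Longrightarrow> x \<otimes> y \<in> W"
proof -
  have T: "topspace T = carrier G" and
    mult: "continuous_map (prod_topology T T) T (\<lambda>(x, y). x \<otimes> y)"
    using assms(1) by (simp_all add: topological_group_def)
  let ?P = "{z \<in> topspace (prod_topology T T). (\<lambda>(x, y). x \<otimes> y) z \<in> W}"
  have "openin (prod_topology T T) ?P"
    using mult assms(4) by (rule openin_continuous_map_preimage)
  moreover have "(a, b) \<in> ?P"
    using assms T by simp
  ultimately have "\<exists>A B. openin T A \<and> openin T B \<and> a \<in> A \<and> b \<in> B \<and> A \<times> B \<subseteq> ?P"
    unfolding openin_prod_topology_alt by (elim allE[of _ a] allE[of _ b] impE)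
  then obtain A B where AB: "openin T A" "openin T B" "a \<in> A" "b \<in> B" "A \<times> B \<subseteq> ?P"
    by (elim exE conjE)
  show thesis
    using AB(5) by (intro that[OF AB(1-4)]) auto
qed

lemma topological_group_open_translate:
  fixes G (structure)
  assumes G: "topological_group G T" and a: "a \<in> carrier G" and W: "openin T W"
  shows "openin T {x \<in> carrier G. a \<otimes> x \<in> W}"
proof (subst openin_subopen, intro ballI)
  have T: "topspace T = carrier G"
    using G by (simp add: topological_group_def)
  fix x assume x: "x \<in> {x \<in> carrier G. a \<otimes> x \<in> W}"
  then obtain A B where AB: "openin T A" "openin T B" "a \<in> A" "x \<in> B"
    "\<And>y z. y \<in> A \<Longrightarrow> z \<in> B \<Longrightarrow> y \<otimes> z \<in> W"
    using topological_group_mult_nbhd[OF G a _ W, of x] by blast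
  then have "B \<subseteq> {x \<in> carrier G. a \<otimes> x \<in> W}"
    using openin_subset[OF AB(2)] T by auto
  with AB(2,4) show "\<exists>B. openin T B \<and> x \<in> B \<and> B \<subseteq> {x \<in> carrier G. a \<otimes> x \<in> W}"
    by (intro exI[of _ B] conjI)
qed

lemma topological_group_cube_nbhd:
  fixes G (structure)
  assumes G: "topological_group G T" and W: "openin T W" "\<one> \<in> W"
  shows "\<exists>V. openin T V \<and> \<one> \<in> V \<and> V \<subseteq> W \<and> (\<forall>x\<in>V. inv x \<in> V) \<and>
           (\<forall>a\<in>V. \<forall>b\<in>V. \<forall>c\<in>V. a \<otimes> b \<otimes> c \<in> W)"
proof -
  have gr: "group G" and T: "topspace T = carrier G" and inv: "continuous_map T T (\<lambda>x. inv x)"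
    using G by (simp_all add: topological_group_def)
  interpret group G by (rule gr)
  obtain A B where AB: "openin T A" "openin T B" "\<one> \<in> A" "\<one> \<in> B"
    "\<And>x y. x \<in> A \<Longrightarrow> y \<in> B \<Longrightarrow> x \<otimes> y \<in> W"
    using topological_group_mult_nbhd[OF G one_closed one_closed W(1)] W(2) by auto
  obtain C D where CD: "openin T C" "openin T D" "\<one> \<in> C" "\<one> \<in> D"
    "\<And>x y. x \<in> C \<Longrightarrow> y \<in> D \<Longrightarrow> x \<otimes> y \<in> A"
    using topological_group_mult_nbhd[OF G one_closed one_closed AB(1)] AB(3) by auto
  define M where "M = W \<inter> B \<inter> C \<inter> D"
  have M: "openin T M" "\<one> \<in> M" "M \<subseteq> W" "M \<subseteq> carrier G"
    using AB CD W openin_subset[OF W(1)] T unfolding M_def by auto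
  define V where "V = M \<inter> {x \<in> topspace T. inv x \<in> M}"
  have "openin T V"
    unfolding V_def using M inv by (intro openin_Int openin_continuous_map_preimage)
  moreover have "\<one> \<in> V" "V \<subseteq> W"
    using M T by (auto simp: V_def)
  moreover have "inv x \<in> V" if "x \<in> V" for x
    using that T by (auto simp: V_def)
  moreover have "a \<otimes> b \<otimes> c \<in> W" if "a \<in> V" "b \<in> V" "c \<in> V" for a b c
    using that AB(5)[of "a \<otimes> b" c] CD(5)[of a b] by (simp add: V_def M_def)
  ultimately show ?thesis
    by blast
qed

text \<open>Intersecting with \<open>B n\<close> at each step makes the shrinking symmetric neighborhoods \<open>V n\<close> a base at the
  identity. The metric is the left-invariant one given by the norm of \<open>chain_norm_exists\<close>.\<close>
theorem Birkhoff_Kakutani: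
  fixes G (structure) and B :: "nat \<Rightarrow> 'a set"
  assumes G: "topological_group G T"
    and B: "\<And>n. openin T (B n) \<and> \<one> \<in> B n"
      "\<And>W. openin T W \<Longrightarrow> \<one> \<in> W \<Longrightarrow> \<exists>n. B n \<subseteq> W"
  shows "metrizable_space T"
proof -
  have gr: "group G" and T: "topspace T = carrier G" and haus: "Hausdorff_space T"
    using G by (simp_all add: topological_group_def)
  interpret group G by (rule gr)
  define shrinks where "shrinks = (\<lambda>W V. openin T V \<and> \<one> \<in> V \<and> V \<subseteq> W \<and> (\<forall>x\<in>V. inv x \<in> V) \<and>
      (\<forall>a\<in>V. \<forall>b\<in>V. \<forall>c\<in>V. a \<otimes> b \<otimes> c \<in> W))"
  have "\<forall>W\<in>{W. openin T W \<and> \<one> \<in> W}. \<exists>V. shrinks W V"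
    using topological_group_cube_nbhd[OF G] by (simp add: shrinks_def)
  from bchoice[OF this] obtain S where "\<forall>W\<in>{W. openin T W \<and> \<one> \<in> W}. shrinks W (S W)"
    by (elim exE)
  then have S: "shrinks W (S W)" if "openin T W" "\<one> \<in> W" for W
    using that by simp
  define V where "V = rec_nat (carrier G) (\<lambda>n W. S (W \<inter> B n))"
  have V_simps: "V 0 = carrier G" "V (Suc n) = S (V n \<inter> B n)" for n
    by (simp_all add: V_def)
  have V: "openin T (V n) \<and> \<one> \<in> V n" for n
  proof (induction n)
    case 0
    show ?case using openin_topspace[of T] by (simp add: V_simps T)
  next
    case (Suc n)
    then show ?case using S[of "V n \<inter> B n"] B(1)[of n] by (simp add: V_simps openin_Int shrinks_def)
  qed
  have VS: "openin T (V n \<inter> B n)" "\<one> \<in> V n \<inter> B n" for n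
    using V[of n] B(1)[of n] by (simp_all add: openin_Int)
  have step: "V (Suc n) \<subseteq> V n \<inter> B n" "\<forall>x\<in>V (Suc n). inv x \<in> V (Suc n)"
    "\<forall>a\<in>V (Suc n). \<forall>b\<in>V (Suc n). \<forall>c\<in>V (Suc n). a \<otimes> b \<otimes> c \<in> V n \<inter> B n" for n
    using S[OF VS[of n]] by (simp_all add: shrinks_def V_simps)
  have "\<exists>N :: 'a \<Rightarrow> real. N \<one> = 0 \<and>
    (\<forall>x\<in>carrier G. 0 \<le> N x \<and> N (inv x) = N x) \<and>
    (\<forall>x\<in>carrier G. \<forall>y\<in>carrier G. N (x \<otimes> y) \<le> N x + N y) \<and>
    (\<forall>x\<in>carrier G. \<forall>n. (N x < 1 / 2 ^ n \<longrightarrow> x \<in> V n) \<and> (x \<in> V n \<longrightarrow> N x \<le> 1 / 2 ^ n))"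
  proof (rule chain_norm_exists)
    show "V 0 = carrier G" "\<And>n. \<one> \<in> V n"
      using V by (simp_all add: V_simps)
    show "inv x \<in> V n" if "x \<in> V n" for n x
      using that step(2) by (cases n) (auto simp: V_simps(1))
    show "V (Suc n) \<subseteq> V n" for n
      using step(1)[of n] by blast
    show "a \<otimes> b \<otimes> c \<in> V n" if "a \<in> V (Suc n)" "b \<in> V (Suc n)" "c \<in> V (Suc n)" for n a b c
      using step(3)[of n] that by blast
  qed
  then obtain N :: "'a \<Rightarrow> real" where N1: "N \<one> = 0"
    and N_nonneg: "\<And>x. x \<in> carrier G \<Longrightarrow> 0 \<le> N x"
    and N_inv: "\<And>x. x \<in> carrier G \<Longrightarrow> N (inv x) = N x"
    and N_mult: "\<And>x y. x \<in> carrier G \<Longrightarrow> y \<in> carrier G \<Longrightarrow> N (x \<otimes> y) \<le> N x + N y"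
    and N_small: "\<And>x n. x \<in> carrier G \<Longrightarrow> N x < 1 / 2 ^ n \<Longrightarrow> x \<in> V n"
    and N_V: "\<And>x n. x \<in> carrier G \<Longrightarrow> x \<in> V n \<Longrightarrow> N x \<le> 1 / 2 ^ n"
    by (elim exE conjE) (rule that; blast)
  have base: "\<exists>n. V n \<subseteq> W" if "openin T W" "\<one> \<in> W" for W
    using B(2)[OF that] step(1) by (meson le_inf_iff subset_trans)
  \<comment> \<open>Off the carrier the distance is \<open>0\<close>, because symmetry and nonnegativity are required everywhere.\<close>
  define d where "d = (\<lambda>x y. if x \<in> carrier G \<and> y \<in> carrier G then N (inv x \<otimes> y) else 0)"
  have d_eq: "d x y = N (inv x \<otimes> y)" if "x \<in> carrier G" "y \<in> carrier G" for x y
    using that by (simp add: d_def)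
  interpret M: Metric_space "carrier G" d
  proof
    show "0 \<le> d x y" for x y
      using N_nonneg by (simp add: d_def)
    show "d x y = d y x" for x y
      using N_inv[of "inv x \<otimes> y"] by (cases "x \<in> carrier G \<and> y \<in> carrier G") (auto simp: d_def inv_mult_group)
    fix x y assume x: "x \<in> carrier G" and y: "y \<in> carrier G"
    show "d x y = 0 \<longleftrightarrow> x = y"
    proof
      assume "d x y = 0"
      let ?z = "inv x \<otimes> y"
      have z: "?z \<in> carrier G" "N ?z = 0"
        using x y \<open>d x y = 0\<close> by (auto simp: d_eq)
      have "?z = \<one>"
      proof (rule ccontr)
        assume "?z \<noteq> \<one>"
        then obtain W where W: "openin T W" "\<one> \<in> W" "?z \<notin> W"
          using haus z(1) T unfolding Hausdorff_space_def disjnt_iff by (metis one_closed)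
        then obtain n where "V n \<subseteq> W"
          using base by blast
        moreover have "?z \<in> V n"
          using N_small[OF z(1)] z(2) by simp
        ultimately show False
          using W(3) by blast
      qed
      then show "x = y"
        using x y by (metis inv_equality inv_inv inv_closed)
    next
      assume "x = y"
      then show "d x y = 0"
        using x N1 by (simp add: d_eq)
    qed
    fix z assume z: "z \<in> carrier G"
    have "y \<otimes> (inv y \<otimes> z) = z"
      using y z by (simp add: m_assoc[symmetric])
    then have "inv x \<otimes> z = (inv x \<otimes> y) \<otimes> (inv y \<otimes> z)"
      using x y z by (simp add: m_assoc)
    then show "d x z \<le> d x y + d y z"
      using N_mult[of "inv x \<otimes> y" "inv y \<otimes> z"] x y z by (simp add: d_eq)
  qed
  have "openin T U \<longleftrightarrow> openin M.mtopology U" for U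
  proof
    assume U: "openin T U"
    have "\<exists>r>0. M.mball x r \<subseteq> U" if "x \<in> U" for x
    proof -
      have x: "x \<in> carrier G"
        using U that T openin_subset by blast
      have "openin T {y \<in> carrier G. x \<otimes> y \<in> U}" "\<one> \<in> {y \<in> carrier G. x \<otimes> y \<in> U}"
        using topological_group_open_translate[OF G x U] x that by auto
      then obtain n where n: "V n \<subseteq> {y \<in> carrier G. x \<otimes> y \<in> U}"
        using base by blast
      have "M.mball x (1 / 2 ^ n) \<subseteq> U"
      proof
        fix y assume "y \<in> M.mball x (1 / 2 ^ n)"
        then have y: "y \<in> carrier G" "N (inv x \<otimes> y) < 1 / 2 ^ n"
          using d_eq[OF x] by auto
        then have "inv x \<otimes> y \<in> V n"
          using N_small x by simp
        then have "x \<otimes> (inv x \<otimes> y) \<in> U"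
          using n by blast
        then show "y \<in> U"
          using x y by (simp add: m_assoc[symmetric])
      qed
      then show ?thesis
        by (intro exI[of _ "1 / 2 ^ n"]) simp
    qed
    then show "openin M.mtopology U"
      using U T openin_subset unfolding M.openin_mtopology by blast
  next
    assume U: "openin M.mtopology U"
    show "openin T U"
    proof (subst openin_subopen, intro ballI)
      fix x assume "x \<in> U"
      with U obtain r where r: "0 < r" "M.mball x r \<subseteq> U" and x: "x \<in> carrier G"
        unfolding M.openin_mtopology by blast
      obtain n where n: "1 / 2 ^ n < r"
        using real_arch_pow_inv[OF r(1), of "1/2"] by (auto simp: power_one_over)
      let ?O = "{y \<in> carrier G. inv x \<otimes> y \<in> V n}"
      have "?O \<subseteq> M.mball x r"
      proof
        fix y assume y: "y \<in> ?O"
        then have "N (inv x \<otimes> y) \<le> 1 / 2 ^ n"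
          using N_V x by simp
        then show "y \<in> M.mball x r"
          using x y n d_eq[OF x] by auto
      qed
      then show "\<exists>O'. openin T O' \<and> x \<in> O' \<and> O' \<subseteq> U"
        using topological_group_open_translate[OF G inv_closed[OF x]] V[of n] r(2) x
        by (intro exI[of _ ?O]) auto
    qed
  qed
  then have "T = M.mtopology"
    by (simp add: topology_eq)
  then show ?thesis
    using M.metrizable_space_mtopology by simp
qed

text \<open>In a topological group the \<open>\<pi>\<close>-character is the character: if \<open>U\<close> is a nonempty open set close to \<open>x\<close>,
  then the translate of \<open>U\<close> by the inverse of one of its points contains the identity and is close to
  it.\<close>
lemma countable_local_pi_base_imp_metrizable:
  fixes G (structure)
  assumes G: "topological_group G T" and x: "x \<in> carrier G" "countable_local_pi_base T x"
  shows "metrizable_space T"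
proof -
  have gr: "group G" and T: "topspace T = carrier G" and inv: "continuous_map T T (\<lambda>x. inv x)"
    using G by (simp_all add: topological_group_def)
  interpret group G by (rule gr)
  from x(2) obtain \<U> where \<U>: "countable \<U>" "\<forall>U\<in>\<U>. openin T U \<and> U \<noteq> {}"
    "\<forall>W. openin T W \<and> x \<in> W \<longrightarrow> (\<exists>U\<in>\<U>. U \<subseteq> W)"
    unfolding countable_local_pi_base_def by (elim exE conjE)
  have "\<exists>U\<in>\<U>. U \<subseteq> topspace T"
    using \<U>(3)[rule_format, of "topspace T"] x(1) T openin_topspace[of T] by simp
  then have ne: "\<U> \<noteq> {}"
    by blast
  define U where "U = from_nat_into \<U>"
  have U_in: "U n \<in> \<U>" for n
    unfolding U_def using ne by (rule from_nat_into)
  define u where "u = (\<lambda>n. SOME y. y \<in> U n)"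
  have u: "u n \<in> U n" for n
    unfolding u_def using \<U>(2) U_in[of n] some_in_eq by blast
  have U_open: "openin T (U n)" for n
    using \<U>(2) U_in by blast
  have u_carrier: "u n \<in> carrier G" for n
    using u[of n] openin_subset[OF U_open[of n]] T by blast
  define B where "B = (\<lambda>n. {y \<in> carrier G. u n \<otimes> y \<in> U n})"
  show ?thesis
  proof (rule Birkhoff_Kakutani[OF G, of B])
    show "openin T (B n) \<and> \<one> \<in> B n" for n
      unfolding B_def using topological_group_open_translate[OF G u_carrier U_open] u u_carrier by simp
    fix W assume W: "openin T W" "\<one> \<in> W"
    obtain P Q where PQ: "openin T P" "openin T Q" "inv x \<in> P" "x \<in> Q"
      "\<And>y z. y \<in> P \<Longrightarrow> z \<in> Q \<Longrightarrow> y \<otimes> z \<in> W"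
      using topological_group_mult_nbhd[OF G inv_closed[OF x(1)] x(1) W(1)] W(2) x(1) by auto
    let ?Q = "Q \<inter> {y \<in> topspace T. inv y \<in> P}"
    have "openin T ?Q"
      using PQ inv by (intro openin_Int openin_continuous_map_preimage)
    moreover have "x \<in> ?Q"
      using PQ x(1) T by simp
    ultimately obtain U' where "U' \<in> \<U>" "U' \<subseteq> ?Q"
      using \<U>(3) by meson
    then obtain n where n: "U n \<subseteq> ?Q"
      unfolding U_def using from_nat_into_surj[OF \<U>(1)] by metis
    have "B n \<subseteq> W"
    proof
      fix y assume y: "y \<in> B n"
      then have "inv (u n) \<in> P" "u n \<otimes> y \<in> Q"
        using n u[of n] by (auto simp: B_def)
      then have "inv (u n) \<otimes> (u n \<otimes> y) \<in> W"
        by (rule PQ(5))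
      then show "y \<in> W"
        using y u_carrier[of n] by (simp add: B_def m_assoc[symmetric])
    qed
    then show "\<exists>n. B n \<subseteq> W"
      by blast
  qed
qed

section \<open>D-spaces in the remainder\<close>

text \<open>A countable subset of a closed discrete \<open>D\<close> is closed in \<open>S\<close>, hence equal to its closure in \<open>X\<close>
  and so compact and discrete, hence finite. Therefore \<open>D\<close> is finite, and the neighborhoods that the
  D-property assigns to its points form a finite subcover.\<close>
lemma D_space_countably_closed_imp_compactin:
  assumes X: "compact_space X" and S: "S \<subseteq> topspace X" "D_space (subtopology X S)"
    and closed: "\<And>A. countable A \<Longrightarrow> A \<subseteq> S \<Longrightarrow> X closure_of A \<subseteq> S"
  shows "compactin X S"
proof -
  let ?Y = "subtopology X S"
  have Y: "topspace ?Y = S"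
    using S(1) by auto
  have discrete_finite: "finite D"
    if D: "closedin ?Y D" "subtopology ?Y D = discrete_topology D" for D
  proof (rule ccontr)
    assume "infinite D"
    then obtain A where A: "A \<subseteq> D" "countable A" "infinite A"
      by (meson infinite_countable_subset')
    have DS: "D \<subseteq> S"
      using closedin_subset[OF D(1)] Y by simp
    have "closedin (subtopology ?Y D) A"
      using A(1) by (simp add: D(2))
    then have "closedin ?Y A"
      using D(1) by (rule closedin_trans_full)
    then obtain K where K: "closedin X K" "A = K \<inter> S"
      unfolding closedin_subtopology by blast
    have "X closure_of A \<subseteq> K"
      using K by (intro closure_of_minimal) auto
    moreover have "X closure_of A \<subseteq> S"
      using A DS by (intro closed) auto
    ultimately have "X closure_of A \<subseteq> A"
      using K(2) by blast
    then have "closedin X A"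
      using A(1) DS S(1) closure_of_subset_eq by (metis subset_trans)
    then have "compactin X A"
      using X closedin_compact_space by blast
    then have "compact_space (subtopology X A)"
      by (simp add: compactin_subspace)
    moreover have "subtopology X A = discrete_topology A"
    proof -
      have "subtopology X A = subtopology (subtopology ?Y D) A"
        using A(1) DS by (simp add: subtopology_subtopology inf.absorb2 Int_absorb1)
      also have "\<dots> = discrete_topology A"
        using A(1) by (simp add: D(2) inf.absorb2)
      finally show ?thesis .
    qed
    ultimately show False
      using A(3) by (simp add: compact_space_discrete_topology)
  qed
  show ?thesis
    unfolding compactin_def
  proof (intro conjI S(1) allI impI)
    fix \<O> assume \<O>: "(\<forall>U\<in>\<O>. openin X U) \<and> S \<subseteq> \<Union>\<O>"
    then have "\<forall>x\<in>S. \<exists>U. U \<in> \<O> \<and> x \<in> U"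
      by blast
    from bchoice[OF this] obtain \<phi> where \<phi>: "\<forall>x\<in>S. \<phi> x \<in> \<O> \<and> x \<in> \<phi> x"
      by (elim exE)
    have "neighborhood_assignment ?Y (\<lambda>x. S \<inter> \<phi> x)"
      unfolding neighborhood_assignment_def Y using \<phi> \<O> by (auto intro: openin_subtopology_Int2)
    then obtain D where D: "closedin ?Y D" "subtopology ?Y D = discrete_topology D" "S = (\<Union>d\<in>D. S \<inter> \<phi> d)"
      using S(2) unfolding D_space_def Y by blast
    have "D \<subseteq> S"
      using closedin_subset[OF D(1)] Y by simp
    then show "\<exists>\<F>. finite \<F> \<and> \<F> \<subseteq> \<O> \<and> S \<subseteq> \<Union>\<F>"
    proof (intro exI[of _ "\<phi> ` D"] conjI)
      show "finite (\<phi> ` D)"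
        using discrete_finite[OF D(1,2)] by simp
      show "\<phi> ` D \<subseteq> \<O>"
        using \<phi> \<open>D \<subseteq> S\<close> by blast
      show "S \<subseteq> \<Union>(\<phi> ` D)"
        by (subst D(3)) auto
    qed
  qed
qed

text \<open>Suppose that the points \<open>Z\<close> with a countable local \<open>\<pi>\<close>-base were dense. They lie in the remainder
  and contain the closures of their countable subsets, so the part of \<open>Z\<close> in the
  closure of a small open set \<open>W\<close> is a D-space with the same closure property, hence compact. Being
  dense in \<open>W\<close>, it contains \<open>W\<close>, which leaves no room for the dense set \<open>S\<close>.\<close>
lemma open_set_without_countable_local_pi_bases:
  assumes X: "compact_space X" "Hausdorff_space X"
    and dense: "X closure_of S = topspace X"
    and D: "locally_hereditarily_D_space (subtopology X (topspace X - S))"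
    and ne: "topspace X \<noteq> {}"
    and no_pi: "\<And>x. x \<in> S \<Longrightarrow> \<not> countable_local_pi_base X x"
  shows "\<exists>U. openin X U \<and> U \<noteq> {} \<and> (\<forall>x\<in>U. \<not> countable_local_pi_base X x)"
proof (rule ccontr)
  assume "\<not> ?thesis"
  then have Z_meets: "\<exists>x\<in>U. countable_local_pi_base X x" if "openin X U" "U \<noteq> {}" for U
    using that by blast
  let ?Y = "subtopology X (topspace X - S)"
  define Z where "Z = {x \<in> topspace X. countable_local_pi_base X x}"
  have Z: "Z \<subseteq> topspace X - S"
    using no_pi unfolding Z_def by blast
  obtain y where y: "y \<in> Z"
    using Z_meets[of "topspace X"] ne unfolding Z_def by auto
  then have "y \<in> topspace ?Y"
    using Z by auto
  then obtain U where U: "openin ?Y U" "y \<in> U" "hereditarily_D_space (subtopology ?Y U)"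
    using D unfolding locally_hereditarily_D_space_def by blast
  then obtain U' where U': "openin X U'" "U = U' \<inter> (topspace X - S)"
    unfolding openin_subtopology by blast
  then have "y \<in> U'"
    using U(2) by blast
  obtain W where W: "openin X W" "y \<in> W" "X closure_of W \<subseteq> U'"
    using regular_space_shrink[OF _ U'(1) \<open>y \<in> U'\<close>] X compact_Hausdorff_imp_regular_space by blast
  define K where "K = Z \<inter> X closure_of W"
  have K: "K \<subseteq> topspace X" "K \<subseteq> topspace X - S" "K \<subseteq> U"
    using Z W(3) U'(2) by (auto simp: K_def)
  have "K \<subseteq> topspace (subtopology ?Y U)"
    using K by simp
  then have "D_space (subtopology (subtopology ?Y U) K)"
    using U(3) by (simp only: hereditarily_D_space_def)
  moreover have "subtopology (subtopology ?Y U) K = subtopology X K"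
    using K by (simp add: subtopology_subtopology inf.absorb2)
  ultimately have "D_space (subtopology X K)"
    by simp
  moreover have "X closure_of A \<subseteq> K" if A: "countable A" "A \<subseteq> K" for A
  proof
    fix x assume x: "x \<in> X closure_of A"
    have "countable_local_pi_base X x"
      using A by (intro countable_local_pi_base_closure_of_countable[OF _ _ x]) (auto simp: K_def Z_def)
    moreover have "x \<in> X closure_of W"
      using x A(2) closure_of_minimal[of A "X closure_of W" X] by (auto simp: K_def)
    ultimately show "x \<in> K"
      using in_closure_of[of x X A] x by (simp add: K_def Z_def)
  qed
  ultimately have "compactin X K"
    using D_space_countably_closed_imp_compactin[OF X(1) K(1)] by simp
  then have "closedin X K"
    using X(2) compactin_imp_closedin by blast
  \<comment> \<open>\<open>K\<close> is closed and contains every point of \<open>Z\<close> in \<open>W\<close>, so density of \<open>Z\<close> makes \<open>W - K\<close> empty.\<close>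
  have "W - K = {}"
  proof (rule ccontr)
    assume "W - K \<noteq> {}"
    then obtain x where x: "x \<in> W - K" "countable_local_pi_base X x"
      using Z_meets[of "W - K"] openin_diff[OF W(1) \<open>closedin X K\<close>] by blast
    then have "x \<in> K"
      using openin_subset[OF W(1)] closure_of_subset[of W X] by (auto simp: K_def Z_def)
    with x(1) show False
      by blast
  qed
  then have "W \<inter> S = {}"
    using K(2) by blast
  moreover have "S \<inter> W \<noteq> {}"
    using dense[unfolded dense_intersects_open, rule_format, of W] W(1,2) by auto
  ultimately show False
    by blast
qed

section \<open>The dichotomy\<close>

theorem theorem4p5:
  fixes G :: "('a, 'b) monoid_scheme" and T bG :: "'a topology"
  assumes "topological_group G T"
    and "Hausdorff_compactification bG T"
    and "locally_hereditarily_D_space (subtopology bG (topspace bG - carrier G))"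
  shows "metrizable_space T \<or> continuously_maps_onto bG Tychonoff_cube_omega_1"
proof (cases "metrizable_space T")
  case False
  have "group G" and T: "topspace T = carrier G"
    using assms(1) by (simp_all add: topological_group_def)
  have bG: "compact_space bG" "Hausdorff_space bG" "carrier G \<subseteq> topspace bG"
    "subtopology bG (carrier G) = T" "bG closure_of (carrier G) = topspace bG"
    using assms(2) by (simp_all add: Hausdorff_compactification_def T)
  have "\<not> countable_local_pi_base bG x" if "x \<in> carrier G" for x
  proof
    assume "countable_local_pi_base bG x"
    from countable_local_pi_base_dense_subspace[OF bG(5) that this]
    have "countable_local_pi_base T x"
      by (simp add: bG(4))
    with countable_local_pi_base_imp_metrizable[OF assms(1) that] False show False
      by blast
  qed
  moreover have "topspace bG \<noteq> {}"
    using group.is_monoid[OF \<open>group G\<close>] monoid.one_closed bG(3) by blast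
  ultimately obtain U where "openin bG U" "U \<noteq> {}" "\<forall>x\<in>U. \<not> countable_local_pi_base bG x"
    using open_set_without_countable_local_pi_bases[OF bG(1,2,5) assms(3)] by blast
  then show ?thesis
    using Shapirovskii_omega_1[OF bG(1,2)] by blast
qed simp

end
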